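(* Let $\mathcal{C}$ be a category and let $e:\mathrm{Id}_{\mathcal{C}}\to\mathrm{Id}_{\mathcal{C}}$ be an idempotent natural transformation. Then the quotient functor $H:\mathcal{C}\to\mathcal{C}_e$ onto the coidentifier category is a coreflection up to retracts, whence a bireflection up to retracts.
   Context: A natural transformation $e:\mathrm{Id}_{\mathcal{C}}\to\mathrm{Id}_{\mathcal{C}}$ is idempotent if $e_X\circ e_X=e_X$ for all $X$. The coidentifier $\mathcal{C}_e$ is the quotient category $\mathcal{C}/\!\sim$, where for $f,g:A\to B$ one sets $f\sim g$ iff $e_B\circ f=e_B\circ g$: it has the same objects as $\mathcal{C}$ and $\mathrm{Hom}_{\mathcal{C}_e}(A,B)=\mathrm{Hom}_{\mathcal{C}}(A,B)/\!\sim$. The quotient functor $H:\mathcal{C}\to\mathcal{C}_e$ is the identity on objects and sends $f$ to its class $\overline{f}$. The idempotent completion $\mathcal{C}^\natural$ of a category $\mathcal{C}$ has as objects the pairs $(X,e)$ with $X$ an object of $\mathcal{C}$ and $e:X\to X$ idempotent; a morphism $f:(X,e)\to(X',e')$ is a morphism $f:X\to X'$ in $\mathcal{C}$ with $f=e'\circ f\circ e$; composition is that of $\mathcal{C}$ and $\mathrm{Id}_{(X,e)}=e$. A functor $F:\mathcal{C}\to\mathcal{D}$ induces its completion $F^\natural:\mathcal{C}^\natural\to\mathcal{D}^\natural$, $F^\natural(X,e)=(FX,Fe)$, $F^\natural(f)=F(f)$. A coreflection is a functor admitting a fully faithful left adjoint. A bireflection is a functor $G:\mathcal{D}\to\mathcal{C}$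 having a fully faithful functor $F:\mathcal{C}\to\mathcal{D}$ which is both a left and a right adjoint of $G$ and such that $\eta^r\circ\epsilon^l=\mathrm{Id}_{FG}$, where $\epsilon^l:FG\to\mathrm{Id}_{\mathcal{D}}$ is the counit of $F\dashv G$ and $\eta^r:\mathrm{Id}_{\mathcal{D}}\to FG$ is the unit of $G\dashv F$. A functor $F$ is a coreflection (resp. bireflection) up to retracts if $F^\natural$ is a coreflection (resp. bireflection). *)

theory Defs
  imports Main
begin

(* Hom-sets are not required to be disjoint, so composition is indexed by the three
   objects involved, and the action of a functor on morphisms by source and target.
   Comp C X Y Z g f is the composite of f : X -> Y followed by g : Y -> Z. *)
record ('o, 'm) cat =
  Ob :: "'o set"
  Hom :: "'o \<Rightarrow> 'o \<Rightarrow> 'm set"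
  Comp :: "'o \<Rightarrow> 'o \<Rightarrow> 'o \<Rightarrow> 'm \<Rightarrow> 'm \<Rightarrow> 'm"
  Idm :: "'o \<Rightarrow> 'm"

locale category =
  fixes C :: "('o, 'm) cat"
  assumes Idm_in_Hom: "X \<in> Ob C \<Longrightarrow> Idm C X \<in> Hom C X X"
    and Comp_in_Hom:
      "\<lbrakk>X \<in> Ob C; Y \<in> Ob C; Z \<in> Ob C; f \<in> Hom C X Y; g \<in> Hom C Y Z\<rbrakk>
        \<Longrightarrow> Comp C X Y Z g f \<in> Hom C X Z"
    and Comp_Idm_right:
      "\<lbrakk>X \<in> Ob C; Y \<in> Ob C; f \<in> Hom C X Y\<rbrakk> \<Longrightarrow> Comp C X X Y f (Idm C X) = f"
    and Comp_Idm_left: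
      "\<lbrakk>X \<in> Ob C; Y \<in> Ob C; f \<in> Hom C X Y\<rbrakk> \<Longrightarrow> Comp C X Y Y (Idm C Y) f = f"
    and Comp_assoc:
      "\<lbrakk>W \<in> Ob C; X \<in> Ob C; Y \<in> Ob C; Z \<in> Ob C;
        f \<in> Hom C W X; g \<in> Hom C X Y; h \<in> Hom C Y Z\<rbrakk>
        \<Longrightarrow> Comp C W Y Z h (Comp C W X Y g f) = Comp C W X Z (Comp C X Y Z h g) f"

record ('o, 'm, 'p, 'n) func =
  FOb :: "'o \<Rightarrow> 'p"
  FMor :: "'o \<Rightarrow> 'o \<Rightarrow> 'm \<Rightarrow> 'n"

locale cat_functor = dom: category C + cod: category D
  for C :: "('o, 'm) cat" and D :: "('p, 'n) cat" +
  fixes F :: "('o, 'm, 'p, 'n) func"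
  assumes FOb_in_Ob: "X \<in> Ob C \<Longrightarrow> FOb F X \<in> Ob D"
    and FMor_in_Hom:
      "\<lbrakk>X \<in> Ob C; Y \<in> Ob C; f \<in> Hom C X Y\<rbrakk> \<Longrightarrow> FMor F X Y f \<in> Hom D (FOb F X) (FOb F Y)"
    and FMor_Idm: "X \<in> Ob C \<Longrightarrow> FMor F X X (Idm C X) = Idm D (FOb F X)"
    and FMor_Comp:
      "\<lbrakk>X \<in> Ob C; Y \<in> Ob C; Z \<in> Ob C; f \<in> Hom C X Y; g \<in> Hom C Y Z\<rbrakk>
        \<Longrightarrow> FMor F X Z (Comp C X Y Z g f)
          = Comp D (FOb F X) (FOb F Y) (FOb F Z) (FMor F Y Z g) (FMor F X Y f)"

definition id_func :: "('o, 'm, 'o, 'm) func" where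
  "id_func = \<lparr>FOb = (\<lambda>X. X), FMor = (\<lambda>X Y f. f)\<rparr>"

definition comp_func ::
  "('p, 'n, 'q, 'l) func \<Rightarrow> ('o, 'm, 'p, 'n) func \<Rightarrow> ('o, 'm, 'q, 'l) func" where
  "comp_func G F =
    \<lparr>FOb = (\<lambda>X. FOb G (FOb F X)),
     FMor = (\<lambda>X Y f. FMor G (FOb F X) (FOb F Y) (FMor F X Y f))\<rparr>"

definition fully_faithful ::
  "('o, 'm) cat \<Rightarrow> ('p, 'n) cat \<Rightarrow> ('o, 'm, 'p, 'n) func \<Rightarrow> bool" where
  "fully_faithful C D F \<longleftrightarrow>
    (\<forall>X\<in>Ob C. \<forall>Y\<in>Ob C. bij_betw (FMor F X Y) (Hom C X Y) (Hom D (FOb F X) (FOb F Y)))"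

locale nat_trans = source: cat_functor C D F + target: cat_functor C D G
  for C :: "('o, 'm) cat" and D :: "('p, 'n) cat"
    and F G :: "('o, 'm, 'p, 'n) func" +
  fixes \<tau> :: "'o \<Rightarrow> 'n"
  assumes component_in_Hom: "X \<in> Ob C \<Longrightarrow> \<tau> X \<in> Hom D (FOb F X) (FOb G X)"
    and naturality:
      "\<lbrakk>X \<in> Ob C; Y \<in> Ob C; f \<in> Hom C X Y\<rbrakk>
        \<Longrightarrow> Comp D (FOb F X) (FOb F Y) (FOb G Y) (\<tau> Y) (FMor F X Y f)
          = Comp D (FOb F X) (FOb G X) (FOb G Y) (FMor G X Y f) (\<tau> X)"

(* F : C -> D is left adjoint to G : D -> C, with unit \<eta> and counit \<epsilon>. *)
locale adjunction =
  left: cat_functor C D F + right: cat_functor D C G +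
  unit: nat_trans C C id_func "comp_func G F" \<eta> +
  counit: nat_trans D D "comp_func F G" id_func \<epsilon>
  for C :: "('o, 'm) cat" and D :: "('p, 'n) cat"
    and F :: "('o, 'm, 'p, 'n) func" and G :: "('p, 'n, 'o, 'm) func"
    and \<eta> :: "'o \<Rightarrow> 'm" and \<epsilon> :: "'p \<Rightarrow> 'n" +
  assumes triangle_left:
      "X \<in> Ob C \<Longrightarrow>
        Comp D (FOb F X) (FOb F (FOb G (FOb F X))) (FOb F X)
          (\<epsilon> (FOb F X)) (FMor F X (FOb G (FOb F X)) (\<eta> X))
        = Idm D (FOb F X)"
    and triangle_right:
      "Y \<in> Ob D \<Longrightarrow>
        Comp C (FOb G Y) (FOb G (FOb F (FOb G Y))) (FOb G Y)
          (FMor G (FOb F (FOb G Y)) Y (\<epsilon> Y)) (\<eta> (FOb G Y))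
        = Idm C (FOb G Y)"

definition coreflection ::
  "('p, 'n) cat \<Rightarrow> ('o, 'm) cat \<Rightarrow> ('p, 'n, 'o, 'm) func \<Rightarrow> bool" where
  "coreflection D C G \<longleftrightarrow>
    cat_functor D C G \<and>
    (\<exists>F \<eta> \<epsilon>. fully_faithful C D F \<and> adjunction C D F G \<eta> \<epsilon>)"

definition bireflection ::
  "('p, 'n) cat \<Rightarrow> ('o, 'm) cat \<Rightarrow> ('p, 'n, 'o, 'm) func \<Rightarrow> bool" where
  "bireflection D C G \<longleftrightarrow>
    cat_functor D C G \<and>
    (\<exists>F \<eta>\<^sub>l \<epsilon>\<^sub>l \<eta>\<^sub>r \<epsilon>\<^sub>r.
      fully_faithful C D F \<and>
      adjunction C D F G \<eta>\<^sub>l \<epsilon>\<^sub>l \<and>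
      adjunction D C G F \<eta>\<^sub>r \<epsilon>\<^sub>r \<and>
      (\<forall>Y\<in>Ob D.
        Comp D (FOb F (FOb G Y)) Y (FOb F (FOb G Y)) (\<eta>\<^sub>r Y) (\<epsilon>\<^sub>l Y)
        = Idm D (FOb F (FOb G Y))))"

definition idempotent_completion :: "('o, 'm) cat \<Rightarrow> ('o \<times> 'm, 'm) cat" where
  "idempotent_completion C =
    \<lparr>Ob = {(X, p). X \<in> Ob C \<and> p \<in> Hom C X X \<and> Comp C X X X p p = p},
     Hom = (\<lambda>(X, p) (Y, q).
       {f \<in> Hom C X Y. f = Comp C X Y Y q (Comp C X X Y f p)}),
     Comp = (\<lambda>(X, p) (Y, q) (Z, r). Comp C X Y Z),
     Idm = (\<lambda>(X, p). p)\<rparr>"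

definition functor_completion ::
  "('o, 'm, 'p, 'n) func \<Rightarrow> ('o \<times> 'm, 'm, 'p \<times> 'n, 'n) func" where
  "functor_completion F =
    \<lparr>FOb = (\<lambda>(X, p). (FOb F X, FMor F X X p)),
     FMor = (\<lambda>(X, p) (Y, q). FMor F X Y)\<rparr>"

definition coreflection_up_to_retracts ::
  "('o, 'm) cat \<Rightarrow> ('p, 'n) cat \<Rightarrow> ('o, 'm, 'p, 'n) func \<Rightarrow> bool" where
  "coreflection_up_to_retracts C D F \<longleftrightarrow>
    cat_functor C D F \<and>
    coreflection (idempotent_completion C) (idempotent_completion D) (functor_completion F)"

definition bireflection_up_to_retracts ::
  "('o, 'm) cat \<Rightarrow> ('p, 'n) cat \<Rightarrow> ('o, 'm, 'p, 'n) func \<Rightarrow> bool" where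
  "bireflection_up_to_retracts C D F \<longleftrightarrow>
    cat_functor C D F \<and>
    bireflection (idempotent_completion C) (idempotent_completion D) (functor_completion F)"

locale idempotent_nat_trans = nat_trans C C id_func id_func e
  for C :: "('o, 'm) cat" and e :: "'o \<Rightarrow> 'm" +
  assumes idempotent: "X \<in> Ob C \<Longrightarrow> Comp C X X X (e X) (e X) = e X"

definition coid_rel :: "('o, 'm) cat \<Rightarrow> ('o \<Rightarrow> 'm) \<Rightarrow> 'o \<Rightarrow> 'o \<Rightarrow> ('m \<times> 'm) set" where
  "coid_rel C e A B =
    {(f, g). f \<in> Hom C A B \<and> g \<in> Hom C A B \<and>
      Comp C A B B (e B) f = Comp C A B B (e B) g}"

(* A morphism of the coidentifier is an equivalence class of morphisms of C; the composite of
   two classes is the class of the composite of any representatives, all of which give the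
   same class. *)
definition coidentifier :: "('o, 'm) cat \<Rightarrow> ('o \<Rightarrow> 'm) \<Rightarrow> ('o, 'm set) cat" where
  "coidentifier C e =
    \<lparr>Ob = Ob C,
     Hom = (\<lambda>A B. Hom C A B // coid_rel C e A B),
     Comp = (\<lambda>A B D V U. \<Union>g\<in>V. \<Union>f\<in>U. coid_rel C e A D `` {Comp C A B D g f}),
     Idm = (\<lambda>A. coid_rel C e A A `` {Idm C A})\<rparr>"

definition quotient_functor ::
  "('o, 'm) cat \<Rightarrow> ('o \<Rightarrow> 'm) \<Rightarrow> ('o, 'm, 'o, 'm set) func" where
  "quotient_functor C e =
    \<lparr>FOb = (\<lambda>A. A), FMor = (\<lambda>A B f. coid_rel C e A B `` {f})\<rparr>"

end

theory Submission
  imports Defs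
begin

text \<open>Sending the class of \<open>f : A \<rightarrow> B\<close> to \<open>e\<^sub>B \<circ> f\<close> is a well-defined section of the quotient
  functor \<open>H\<close>. It preserves composition but sends the identity of \<open>A\<close> to \<open>e\<^sub>A\<close>, so it is only a
  semifunctor \<open>K\<close>. A semifunctor still induces a functor between idempotent completions. There
  \<open>H K = Id\<close> holds strictly, while \<open>K H\<close> sends \<open>(X, p)\<close> to its retract \<open>(X, e\<^sub>X \<circ> p)\<close>, and
  \<open>e\<^sub>X \<circ> p\<close>, viewed as a morphism in either direction between these two objects, is both the
  counit of \<open>K \<stileturn> H\<close> and the unit of \<open>H \<stileturn> K\<close>.\<close>

section \<open>Idempotent completions and the functors induced by semifunctors\<close>

locale semifunctor = dom: category C + cod: category D
  for C :: "('o, 'm) cat" and D :: "('p, 'n) cat" +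
  fixes F :: "('o, 'm, 'p, 'n) func"
  assumes semi_Ob: "X \<in> Ob C \<Longrightarrow> FOb F X \<in> Ob D"
    and semi_Hom:
      "\<lbrakk>X \<in> Ob C; Y \<in> Ob C; f \<in> Hom C X Y\<rbrakk> \<Longrightarrow> FMor F X Y f \<in> Hom D (FOb F X) (FOb F Y)"
    and semi_Comp:
      "\<lbrakk>X \<in> Ob C; Y \<in> Ob C; Z \<in> Ob C; f \<in> Hom C X Y; g \<in> Hom C Y Z\<rbrakk>
        \<Longrightarrow> FMor F X Z (Comp C X Y Z g f)
          = Comp D (FOb F X) (FOb F Y) (FOb F Z) (FMor F Y Z g) (FMor F X Y f)"

text \<open>Lets the construction on completions below, carried out once for semifunctors, serve
  both the quotient functor and its section.\<close>

sublocale cat_functor \<subseteq> semifunctor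
  by unfold_locales (auto intro: FOb_in_Ob FMor_in_Hom FMor_Comp)

lemma idempotent_completion_Ob:
  "(X, p) \<in> Ob (idempotent_completion C)
    \<longleftrightarrow> X \<in> Ob C \<and> p \<in> Hom C X X \<and> Comp C X X X p p = p"
  by (simp add: idempotent_completion_def)

lemma idempotent_completion_Comp:
  "Comp (idempotent_completion C) (X, p) (Y, q) (Z, r) = Comp C X Y Z"
  by (simp add: idempotent_completion_def)

lemma idempotent_completion_Idm: "Idm (idempotent_completion C) (X, p) = p"
  by (simp add: idempotent_completion_def)

text \<open>Composing \<open>f = q \<circ> f \<circ> p\<close> once more with \<open>q\<close> or
  \<open>p\<close> changes nothing, as both are idempotent. The resulting pair of one-sided
  absorption laws is far easier to rewrite with than the two-sided equation.\<close>

lemma (in category) idempotent_completion_Hom: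
  assumes "(X, p) \<in> Ob (idempotent_completion C)" "(Y, q) \<in> Ob (idempotent_completion C)"
  shows "f \<in> Hom (idempotent_completion C) (X, p) (Y, q)
    \<longleftrightarrow> f \<in> Hom C X Y \<and> Comp C X Y Y q f = f \<and> Comp C X X Y f p = f"
proof
  have X: "X \<in> Ob C" "p \<in> Hom C X X" "Comp C X X X p p = p"
    and Y: "Y \<in> Ob C" "q \<in> Hom C Y Y" "Comp C Y Y Y q q = q"
    using assms by (auto simp: idempotent_completion_Ob)
  assume "f \<in> Hom (idempotent_completion C) (X, p) (Y, q)"
  then have f: "f \<in> Hom C X Y" and eq: "f = Comp C X Y Y q (Comp C X X Y f p)"
    by (auto simp: idempotent_completion_def)
  have fp: "Comp C X X Y f p \<in> Hom C X Y"
    using X Y f by (auto intro: Comp_in_Hom)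
  \<comment> \<open>Read \<open>f\<close> as \<open>q \<circ> (f \<circ> p)\<close>: the extra
    \<open>q\<close> merges with the one already there.\<close>
  have "Comp C X Y Y q f = f"
    using Comp_assoc[of X Y Y Y "Comp C X X Y f p" q q] X Y fp by (simp flip: eq)
  moreover have "Comp C X X Y f p = f"
  proof -
    have "Comp C X X Y (Comp C X X Y f p) p = Comp C X X Y f p"
      using Comp_assoc[of X X X Y p p f] X Y f by simp
    moreover have "Comp C X X Y (Comp C X Y Y q (Comp C X X Y f p)) p
        = Comp C X Y Y q (Comp C X X Y (Comp C X X Y f p) p)"
      using Comp_assoc[of X X Y Y p "Comp C X X Y f p" q] X Y fp by simp
    ultimately show ?thesis by (simp flip: eq)
  qed
  ultimately show "f \<in> Hom C X Y \<and> Comp C X Y Y q f = f \<and> Comp C X X Y f p = f"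
    using f by blast
qed (auto simp: idempotent_completion_def)

text \<open>The identity of \<open>(X, p)\<close> is \<open>p\<close>, so the unit laws are exactly
  the absorption laws; a composite is absorbed at each end by its outer factor.\<close>

lemma (in category) category_idempotent_completion: "category (idempotent_completion C)"
proof
  fix P assume "P \<in> Ob (idempotent_completion C)"
  then show "Idm (idempotent_completion C) P \<in> Hom (idempotent_completion C) P P"
    by (cases P) (auto simp: idempotent_completion_Hom idempotent_completion_Idm
        idempotent_completion_Ob)
next
  fix P Q R f g
  assume "P \<in> Ob (idempotent_completion C)" "Q \<in> Ob (idempotent_completion C)"
    "R \<in> Ob (idempotent_completion C)" "f \<in> Hom (idempotent_completion C) P Q"
    "g \<in> Hom (idempotent_completion C) Q R"
  moreover obtain X p Y q Z r where "P = (X, p)" "Q = (Y, q)" "R = (Z, r)"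
    by (cases P, cases Q, cases R)
  ultimately show "Comp (idempotent_completion C) P Q R g f \<in> Hom (idempotent_completion C) P R"
    using Comp_assoc[of X Y Z Z f g r] Comp_assoc[of X X Y Z p f g]
    by (auto simp: idempotent_completion_Hom idempotent_completion_Comp
        idempotent_completion_Ob Comp_in_Hom)
next
  fix P Q f
  assume "P \<in> Ob (idempotent_completion C)" "Q \<in> Ob (idempotent_completion C)"
    "f \<in> Hom (idempotent_completion C) P Q"
  then show "Comp (idempotent_completion C) P P Q f (Idm (idempotent_completion C) P) = f"
    and "Comp (idempotent_completion C) P Q Q (Idm (idempotent_completion C) Q) f = f"
    by (cases P; cases Q; simp add: idempotent_completion_Hom idempotent_completion_Comp
        idempotent_completion_Idm)+
next
  fix P Q R S f g h
  assume "P \<in> Ob (idempotent_completion C)" "Q \<in> Ob (idempotent_completion C)"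
    "R \<in> Ob (idempotent_completion C)" "S \<in> Ob (idempotent_completion C)"
    "f \<in> Hom (idempotent_completion C) P Q" "g \<in> Hom (idempotent_completion C) Q R"
    "h \<in> Hom (idempotent_completion C) R S"
  then show "Comp (idempotent_completion C) P R S h (Comp (idempotent_completion C) P Q R g f)
    = Comp (idempotent_completion C) P Q S (Comp (idempotent_completion C) Q R S h g) f"
    by (cases P; cases Q; cases R; cases S)
      (simp add: idempotent_completion_Hom idempotent_completion_Comp,
        simp add: idempotent_completion_Ob Comp_assoc)
qed

lemma functor_completion_FOb: "FOb (functor_completion F) (X, p) = (FOb F X, FMor F X X p)"
  by (simp add: functor_completion_def)

lemma functor_completion_FMor: "FMor (functor_completion F) (X, p) (Y, q) = FMor F X Y"
  by (simp add: functor_completion_def)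

lemmas completion_simps =
  idempotent_completion_Comp idempotent_completion_Idm
  functor_completion_FOb functor_completion_FMor

lemma (in semifunctor) functor_completion_Ob:
  assumes "(X, p) \<in> Ob (idempotent_completion C)"
  shows "(FOb F X, FMor F X X p) \<in> Ob (idempotent_completion D)"
  using assms semi_Comp[of X X X p p]
  by (auto simp: idempotent_completion_Ob semi_Ob semi_Hom)

text \<open>The identity of \<open>(X, p)\<close> is \<open>p\<close>, and its image under
  \<open>F\<close> is by construction the identity of the image object. Preservation of composition
  thus turns a semifunctor into a genuine functor of completions.\<close>

lemma (in semifunctor) functor_completion_is_functor:
  "cat_functor (idempotent_completion C) (idempotent_completion D) (functor_completion F)"
proof -
  interpret C': category "idempotent_completion C"
    by (rule dom.category_idempotent_completion)
  interpret D': category "idempotent_completion D"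
    by (rule cod.category_idempotent_completion)
  show ?thesis
  proof
    fix P assume "P \<in> Ob (idempotent_completion C)"
    then show "FOb (functor_completion F) P \<in> Ob (idempotent_completion D)"
      and "FMor (functor_completion F) P P (Idm (idempotent_completion C) P)
        = Idm (idempotent_completion D) (FOb (functor_completion F) P)"
      by (cases P; simp add: completion_simps functor_completion_Ob)+
  next
    fix P Q f
    assume "P \<in> Ob (idempotent_completion C)" "Q \<in> Ob (idempotent_completion C)"
      "f \<in> Hom (idempotent_completion C) P Q"
    moreover obtain X p Y q where "P = (X, p)" "Q = (Y, q)"
      by (cases P, cases Q)
    ultimately show "FMor (functor_completion F) P Q f
        \<in> Hom (idempotent_completion D) (FOb (functor_completion F) P) (FOb (functor_completion F) Q)"
      \<comment> \<open>Applying \<open>F\<close> to \<open>f \<circ> p = f\<close> and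
        \<open>q \<circ> f = f\<close> gives the absorption laws for the image of
        \<open>f\<close>.\<close>
      using semi_Comp[of X X Y p f] semi_Comp[of X Y Y f q]
      by (simp add: completion_simps functor_completion_Ob cod.idempotent_completion_Hom
          dom.idempotent_completion_Hom) (simp add: idempotent_completion_Ob semi_Hom)
  next
    fix P Q R f g
    assume "P \<in> Ob (idempotent_completion C)" "Q \<in> Ob (idempotent_completion C)"
      "R \<in> Ob (idempotent_completion C)"
      "f \<in> Hom (idempotent_completion C) P Q" "g \<in> Hom (idempotent_completion C) Q R"
    then show "FMor (functor_completion F) P R (Comp (idempotent_completion C) P Q R g f)
      = Comp (idempotent_completion D) (FOb (functor_completion F) P)
          (FOb (functor_completion F) Q) (FOb (functor_completion F) R)
          (FMor (functor_completion F) Q R g) (FMor (functor_completion F) P Q f)"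
      by (cases P; cases Q; cases R)
        (simp add: completion_simps dom.idempotent_completion_Hom,
          simp add: idempotent_completion_Ob semi_Comp)
  qed
qed

section \<open>Identity and composite functors\<close>

lemma cat_functor_id_func: "category C \<Longrightarrow> cat_functor C C id_func"
  by (simp add: cat_functor_def cat_functor_axioms_def id_func_def)

lemma cat_functor_comp_func:
  assumes "cat_functor C D F" "cat_functor D E G"
  shows "cat_functor C E (comp_func G F)"
proof -
  interpret F: cat_functor C D F by fact
  interpret G: cat_functor D E G by fact
  show ?thesis
    by unfold_locales
      (simp_all add: comp_func_def F.FOb_in_Ob F.FMor_in_Hom F.FMor_Idm F.FMor_Comp
        G.FOb_in_Ob G.FMor_in_Hom G.FMor_Idm G.FMor_Comp)
qed

section \<open>Calculus of an idempotent natural transformation\<close>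

context idempotent_nat_trans
begin

abbreviation "Q \<equiv> coidentifier C e"
abbreviation "cls A B f \<equiv> coid_rel C e A B `` {f}"

text \<open>The representative is arbitrary: two morphisms are equivalent precisely when they agree
  after composition with \<open>e B\<close>, so the value depends on the class alone.\<close>

definition lift :: "'o \<Rightarrow> 'o \<Rightarrow> 'm set \<Rightarrow> 'm" where
  "lift A B U = Comp C A B B (e B) (SOME f. f \<in> U)"

lemma e_in_Hom: "X \<in> Ob C \<Longrightarrow> e X \<in> Hom C X X"
  using component_in_Hom by (simp add: id_func_def)

lemma e_natural:
  "\<lbrakk>X \<in> Ob C; Y \<in> Ob C; f \<in> Hom C X Y\<rbrakk> \<Longrightarrow> Comp C X Y Y (e Y) f = Comp C X X Y f (e X)"
  using naturality by (simp add: id_func_def)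

lemmas Comp_in_Hom = source.dom.Comp_in_Hom
lemmas Comp_assoc = source.dom.Comp_assoc

lemma e_absorb:
  "\<lbrakk>A \<in> Ob C; B \<in> Ob C; f \<in> Hom C A B\<rbrakk>
    \<Longrightarrow> Comp C A B B (e B) (Comp C A B B (e B) f) = Comp C A B B (e B) f"
  by (simp add: Comp_assoc e_in_Hom idempotent)

text \<open>Naturality moves \<open>e\<close> from the middle of a composite to its left
  end.\<close>

lemma e_middle:
  assumes "A \<in> Ob C" "B \<in> Ob C" "D \<in> Ob C" "f \<in> Hom C A B" "g \<in> Hom C B D"
  shows "Comp C A B D g (Comp C A B B (e B) f) = Comp C A D D (e D) (Comp C A B D g f)"
  using assms e_natural[of B D g] by (simp add: Comp_assoc e_in_Hom)

text \<open>Naturality collects both copies of \<open>e\<close> on the left, where idempotence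
  merges them. This one identity makes composition of classes well defined and makes the section
  preserve composition.\<close>

lemma e_comp:
  assumes "A \<in> Ob C" "B \<in> Ob C" "D \<in> Ob C" "f \<in> Hom C A B" "g \<in> Hom C B D"
  shows "Comp C A B D (Comp C B D D (e D) g) (Comp C A B B (e B) f)
    = Comp C A D D (e D) (Comp C A B D g f)"
proof -
  have "Comp C A B D (Comp C B D D (e D) g) (Comp C A B B (e B) f)
      = Comp C A D D (e D) (Comp C A B D g (Comp C A B B (e B) f))"
    using assms Comp_assoc[of A B D D "Comp C A B B (e B) f" g "e D"]
    by (simp add: Comp_in_Hom e_in_Hom)
  then show ?thesis
    using assms by (simp add: e_middle Comp_in_Hom e_absorb)
qed

section \<open>The coidentifier category and the quotient functor\<close>

lemma in_cls: "f \<in> Hom C A B \<Longrightarrow> f \<in> cls A B f"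
  by (simp add: coid_rel_def)

lemma cls_eq_iff:
  assumes "f \<in> Hom C A B" "g \<in> Hom C A B"
  shows "cls A B f = cls A B g \<longleftrightarrow> Comp C A B B (e B) f = Comp C A B B (e B) g"
  using assms by (auto simp: coid_rel_def)

lemma Ob_Q: "Ob Q = Ob C"
  by (simp add: coidentifier_def)

lemma Idm_Q: "Idm Q A = cls A A (Idm C A)"
  by (simp add: coidentifier_def)

lemma cls_in_Hom: "f \<in> Hom C A B \<Longrightarrow> cls A B f \<in> Hom Q A B"
  by (auto simp: coidentifier_def intro: quotientI)

lemma Hom_QE:
  assumes "U \<in> Hom Q A B"
  obtains f where "f \<in> Hom C A B" "U = cls A B f"
  using assms by (auto simp: coidentifier_def elim: quotientE)

text \<open>Composition in \<open>Q\<close> is a union over all representatives; by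
  \<open>e_comp\<close> every set in that union is the same class.\<close>

lemma Comp_cls:
  assumes "A \<in> Ob C" "B \<in> Ob C" "D \<in> Ob C" "f \<in> Hom C A B" "g \<in> Hom C B D"
  shows "Comp Q A B D (cls B D g) (cls A B f) = cls A D (Comp C A B D g f)"
proof -
  have *: "cls A D (Comp C A B D g' f') = cls A D (Comp C A B D g f)"
    if "g' \<in> cls B D g" "f' \<in> cls A B f" for g' f'
    using that assms e_comp[of A B D f g] e_comp[of A B D f' g']
    by (subst cls_eq_iff) (auto simp: coid_rel_def Comp_in_Hom)
  have "Comp Q A B D (cls B D g) (cls A B f)
      = (\<Union>g'\<in>cls B D g. \<Union>f'\<in>cls A B f. cls A D (Comp C A B D g' f'))"
    by (simp add: coidentifier_def)
  also have "\<dots> = (\<Union>g'\<in>cls B D g. \<Union>f'\<in>cls A B f. cls A D (Comp C A B D g f))"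
    using * by simp
  \<comment> \<open>A union of constant sets collapses because both index classes are inhabited, by
    \<open>g\<close> and \<open>f\<close> themselves.\<close>
  also have "\<dots> = cls A D (Comp C A B D g f)"
    using in_cls assms by blast
  finally show ?thesis .
qed

lemma category_Q: "category Q"
proof
  fix X assume "X \<in> Ob Q"
  then show "Idm Q X \<in> Hom Q X X"
    by (simp add: Ob_Q Idm_Q cls_in_Hom source.dom.Idm_in_Hom)
next
  fix X Y Z U V
  assume "X \<in> Ob Q" "Y \<in> Ob Q" "Z \<in> Ob Q" "U \<in> Hom Q X Y" "V \<in> Hom Q Y Z"
  then show "Comp Q X Y Z V U \<in> Hom Q X Z"
    by (auto elim!: Hom_QE simp: Ob_Q Comp_cls Comp_in_Hom cls_in_Hom)
next
  fix X Y U assume "X \<in> Ob Q" "Y \<in> Ob Q" "U \<in> Hom Q X Y"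
  then show "Comp Q X X Y U (Idm Q X) = U" and "Comp Q X Y Y (Idm Q Y) U = U"
    by (auto elim!: Hom_QE simp: Ob_Q Idm_Q Comp_cls source.dom.Idm_in_Hom
        source.dom.Comp_Idm_left source.dom.Comp_Idm_right)
next
  fix W X Y Z S U V
  assume "W \<in> Ob Q" "X \<in> Ob Q" "Y \<in> Ob Q" "Z \<in> Ob Q"
    "S \<in> Hom Q W X" "U \<in> Hom Q X Y" "V \<in> Hom Q Y Z"
  then show "Comp Q W Y Z V (Comp Q W X Y U S) = Comp Q W X Z (Comp Q X Y Z V U) S"
    by (auto elim!: Hom_QE simp: Ob_Q Comp_cls Comp_in_Hom Comp_assoc)
qed

lemma quotient_functor_is_functor: "cat_functor C Q (quotient_functor C e)"
proof -
  interpret Q: category Q by (rule category_Q)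
  show ?thesis
    by unfold_locales (simp_all add: quotient_functor_def Ob_Q Idm_Q cls_in_Hom Comp_cls)
qed

section \<open>The section of the quotient functor as a semifunctor\<close>

lemma lift_cls:
  assumes "f \<in> Hom C A B"
  shows "lift A B (cls A B f) = Comp C A B B (e B) f"
proof -
  have "Comp C A B B (e B) g = Comp C A B B (e B) f" if "g \<in> cls A B f" for g
    using that by (simp add: coid_rel_def)
  \<comment> \<open>The class contains \<open>f\<close>, so the choice returns a genuine
    representative, and all of these agree after composition with \<open>e B\<close>.\<close>
  then show ?thesis
    unfolding lift_def by (rule someI2[where P = \<open>\<lambda>g. g \<in> cls A B f\<close>, OF in_cls[OF assms]])
qed

text \<open>By idempotence, \<open>e B \<circ> f\<close> is another representative of the class of
  \<open>f\<close>.\<close>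

lemma cls_e_comp:
  "\<lbrakk>A \<in> Ob C; B \<in> Ob C; f \<in> Hom C A B\<rbrakk> \<Longrightarrow> cls A B (Comp C A B B (e B) f) = cls A B f"
  by (subst cls_eq_iff) (simp_all add: Comp_in_Hom e_in_Hom e_absorb)

lemma lift_in_Hom:
  "\<lbrakk>A \<in> Ob C; B \<in> Ob C; U \<in> Hom Q A B\<rbrakk> \<Longrightarrow> lift A B U \<in> Hom C A B"
  by (auto elim!: Hom_QE simp: lift_cls Comp_in_Hom e_in_Hom)

text \<open>This is the strict equality \<open>H K = Id\<close> on morphisms; it also makes the
  section injective on hom-sets.\<close>

lemma cls_lift: "\<lbrakk>A \<in> Ob C; B \<in> Ob C; U \<in> Hom Q A B\<rbrakk> \<Longrightarrow> cls A B (lift A B U) = U"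
  by (elim Hom_QE) (simp add: lift_cls cls_e_comp)

text \<open>Idempotence fixes every lifted morphism under \<open>e\<close>; fullness of
  \<open>K'\<close> and the triangle identities rest on this.\<close>

lemma e_lift:
  "\<lbrakk>A \<in> Ob C; B \<in> Ob C; U \<in> Hom Q A B\<rbrakk> \<Longrightarrow> Comp C A B B (e B) (lift A B U) = lift A B U"
  by (auto elim!: Hom_QE simp: lift_cls e_absorb)

lemma lift_Comp:
  "\<lbrakk>A \<in> Ob C; B \<in> Ob C; D \<in> Ob C; U \<in> Hom Q A B; V \<in> Hom Q B D\<rbrakk>
    \<Longrightarrow> lift A D (Comp Q A B D V U) = Comp C A B D (lift B D V) (lift A B U)"
  by (auto elim!: Hom_QE simp: Comp_cls lift_cls Comp_in_Hom e_comp)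

definition lift_func :: "('o, 'm set, 'o, 'm) func" where
  "lift_func = \<lparr>FOb = (\<lambda>A. A), FMor = lift\<rparr>"

lemma semifunctor_lift: "semifunctor Q C lift_func"
proof -
  interpret Q: category Q by (rule category_Q)
  show ?thesis
    by unfold_locales (simp_all add: lift_func_def Ob_Q lift_in_Hom lift_Comp)
qed

section \<open>The induced functors between the completions\<close>

abbreviation "C' \<equiv> idempotent_completion C"
abbreviation "Q' \<equiv> idempotent_completion Q"
abbreviation "H' \<equiv> functor_completion (quotient_functor C e)"
abbreviation "K' \<equiv> functor_completion lift_func"
text \<open>The same element of \<open>Hom C X X\<close> is read as a morphism from the retract
  \<open>(X, e X \<circ> p)\<close> to \<open>(X, p)\<close> and as one back, since hom-sets may
  overlap.\<close>

abbreviation "\<epsilon> \<equiv> \<lambda>(X, p). Comp C X X X (e X) p"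

lemma functor_H': "cat_functor C' Q' H'"
proof -
  interpret H: cat_functor C Q "quotient_functor C e" by (rule quotient_functor_is_functor)
  show ?thesis by (rule H.functor_completion_is_functor)
qed

lemma functor_K': "cat_functor Q' C' K'"
  using semifunctor_lift by (rule semifunctor.functor_completion_is_functor)

lemma H'_simps:
  "FOb H' (X, p) = (X, cls X X p)" "FMor H' (X, p) (Y, q) f = cls X Y f"
  by (simp_all add: completion_simps quotient_functor_def)

lemma K'_simps:
  "FOb K' (X, U) = (X, lift X X U)" "FMor K' (X, U) (Y, V) W = lift X Y W"
  by (simp_all add: completion_simps lift_func_def)

lemma Ob_C'E:
  assumes "P \<in> Ob C'"
  obtains X p where "P = (X, p)" "X \<in> Ob C" "p \<in> Hom C X X" "Comp C X X X p p = p"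
  using assms by (cases P) (auto simp: idempotent_completion_Ob)

lemma Ob_Q'E:
  assumes "P \<in> Ob Q'"
  obtains X U where "P = (X, U)" "X \<in> Ob C" "U \<in> Hom Q X X" "Comp Q X X X U U = U"
  using assms by (cases P) (auto simp: idempotent_completion_Ob Ob_Q)

lemma Hom_C'_iff:
  assumes "X \<in> Ob C" "p \<in> Hom C X X" "Comp C X X X p p = p"
    and "Y \<in> Ob C" "q \<in> Hom C Y Y" "Comp C Y Y Y q q = q"
  shows "f \<in> Hom C' (X, p) (Y, q)
    \<longleftrightarrow> f \<in> Hom C X Y \<and> Comp C X Y Y q f = f \<and> Comp C X X Y f p = f"
  using assms by (simp add: source.dom.idempotent_completion_Hom idempotent_completion_Ob)

lemma Hom_Q'_iff:
  assumes "X \<in> Ob C" "U \<in> Hom Q X X" "Comp Q X X X U U = U"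
    and "Y \<in> Ob C" "V \<in> Hom Q Y Y" "Comp Q Y Y Y V V = V"
  shows "W \<in> Hom Q' (X, U) (Y, V)
    \<longleftrightarrow> W \<in> Hom Q X Y \<and> Comp Q X Y Y V W = W \<and> Comp Q X X Y W U = W"
  using assms category.idempotent_completion_Hom[OF category_Q]
  by (simp add: idempotent_completion_Ob Ob_Q)

text \<open>Taking classes inverts \<open>lift\<close> on each hom-set between objects in the image
  of \<open>K'\<close>.\<close>

lemma fully_faithful_K': "fully_faithful Q' C' K'"
  unfolding fully_faithful_def
proof (intro ballI)
  fix P R assume "P \<in> Ob Q'" "R \<in> Ob Q'"
  then obtain X U Y V where
    P: "P = (X, U)" "X \<in> Ob C" "U \<in> Hom Q X X" "Comp Q X X X U U = U"
    and R: "R = (Y, V)" "Y \<in> Ob C" "V \<in> Hom Q Y Y" "Comp Q Y Y Y V V = V"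
    by (elim Ob_Q'E)
  \<comment> \<open>Lifts of the idempotents \<open>U\<close> and \<open>V\<close> are idempotent,
    so the images of \<open>P\<close> and \<open>R\<close> satisfy the conditions of
    \<open>Hom_C'_iff\<close>.\<close>
  note idem = lift_Comp[of X X X U U] lift_Comp[of Y Y Y V V]
  have K: "FMor K' P R = lift X Y"
    by (simp add: P(1) R(1) completion_simps lift_func_def)
  have iff: "f \<in> Hom C' (FOb K' P) (FOb K' R) \<longleftrightarrow> f \<in> Hom C X Y
      \<and> Comp C X Y Y (lift Y Y V) f = f \<and> Comp C X X Y f (lift X X U) = f" for f
    using idem P R by (simp add: K'_simps Hom_C'_iff lift_in_Hom)
  have iffQ: "W \<in> Hom Q' P R
      \<longleftrightarrow> W \<in> Hom Q X Y \<and> Comp Q X Y Y V W = W \<and> Comp Q X X Y W U = W" for W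
    using P R by (simp add: Hom_Q'_iff)
  show "bij_betw (FMor K' P R) (Hom Q' P R) (Hom C' (FOb K' P) (FOb K' R))"
    unfolding K
  proof (rule bij_betw_byWitness[where f' = "\<lambda>f. cls X Y f"])
    show "\<forall>W\<in>Hom Q' P R. cls X Y (lift X Y W) = W"
      using P(2-4) R(2-4) by (simp add: iffQ cls_lift)
    show "\<forall>f\<in>Hom C' (FOb K' P) (FOb K' R). lift X Y (cls X Y f) = f"
    proof
      fix f assume "f \<in> Hom C' (FOb K' P) (FOb K' R)"
      \<comment> \<open>The left side is \<open>e Y \<circ> f\<close>. Here \<open>f\<close> factors
        as \<open>lift Y Y V \<circ> f\<close>, and \<open>lift Y Y V\<close> absorbs
        \<open>e Y\<close>.\<close>
      then show "lift X Y (cls X Y f) = f"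
        using P(2-4) R(2-4) Comp_assoc[of X Y Y Y f "lift Y Y V" "e Y"]
        by (simp add: iff lift_cls lift_in_Hom e_in_Hom e_lift)
    qed
    show "lift X Y ` Hom Q' P R \<subseteq> Hom C' (FOb K' P) (FOb K' R)"
    proof (rule image_subsetI)
      fix W assume "W \<in> Hom Q' P R"
      then show "lift X Y W \<in> Hom C' (FOb K' P) (FOb K' R)"
        using P(2-4) R(2-4) lift_Comp[of X Y Y W V] lift_Comp[of X X Y U W]
        by (simp add: iff iffQ lift_in_Hom)
    qed
    show "(\<lambda>f. cls X Y f) ` Hom C' (FOb K' P) (FOb K' R) \<subseteq> Hom Q' P R"
    proof (rule image_subsetI)
      fix f assume "f \<in> Hom C' (FOb K' P) (FOb K' R)"
      \<comment> \<open>Passing to classes in the absorption laws of \<open>f\<close> turns the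
        lifts of \<open>U\<close> and \<open>V\<close> back into \<open>U\<close> and
        \<open>V\<close>.\<close>
      then show "cls X Y f \<in> Hom Q' P R"
        using P(2-4) R(2-4) Comp_cls[of X Y Y f "lift Y Y V"] Comp_cls[of X X Y "lift X X U" f]
        by (simp add: iff iffQ cls_in_Hom lift_in_Hom cls_lift)
    qed
  qed
qed

section \<open>Natural transformations and adjunctions between the completions\<close>

lemma functor_H'K': "cat_functor Q' Q' (comp_func H' K')"
  by (rule cat_functor_comp_func[OF functor_K' functor_H'])

lemma functor_K'H': "cat_functor C' C' (comp_func K' H')"
  by (rule cat_functor_comp_func[OF functor_H' functor_K'])

text \<open>Naturality and idempotence show that \<open>(X, e X \<circ> p)\<close> is an object of
  \<open>C'\<close> and that \<open>e X \<circ> p\<close> is a morphism between it and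
  \<open>(X, p)\<close> in both directions.\<close>

lemma retract_idem:
  assumes "X \<in> Ob C" "p \<in> Hom C X X" "Comp C X X X p p = p"
  shows "Comp C X X X (e X) p \<in> Hom C X X"
    and "Comp C X X X p (Comp C X X X (e X) p) = Comp C X X X (e X) p"
    and "Comp C X X X (Comp C X X X (e X) p) p = Comp C X X X (e X) p"
    and "Comp C X X X (Comp C X X X (e X) p) (Comp C X X X (e X) p) = Comp C X X X (e X) p"
proof -
  show "Comp C X X X (e X) p \<in> Hom C X X"
    using assms by (simp add: Comp_in_Hom e_in_Hom)
  show "Comp C X X X p (Comp C X X X (e X) p) = Comp C X X X (e X) p"
    using assms by (simp add: e_middle)
  show "Comp C X X X (Comp C X X X (e X) p) p = Comp C X X X (e X) p"
    using assms by (simp add: e_in_Hom flip: Comp_assoc)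
  show "Comp C X X X (Comp C X X X (e X) p) (Comp C X X X (e X) p) = Comp C X X X (e X) p"
    using assms by (simp add: e_comp)
qed

text \<open>As \<open>K' H'\<close> sends \<open>f\<close> to \<open>e Y \<circ> f\<close>, these
  four composites are the sides of the naturality squares of \<open>\<epsilon>\<close> in its two
  directions; all of them equal \<open>e Y \<circ> f\<close>.\<close>

lemma retract_natural:
  assumes "X \<in> Ob C" "p \<in> Hom C X X" "Y \<in> Ob C" "q \<in> Hom C Y Y"
    and "f \<in> Hom C X Y" "Comp C X Y Y q f = f" "Comp C X X Y f p = f"
  shows "Comp C X Y Y (Comp C Y Y Y (e Y) q) f = Comp C X Y Y (e Y) f"
    and "Comp C X X Y f (Comp C X X X (e X) p) = Comp C X Y Y (e Y) f"
    and "Comp C X Y Y (Comp C Y Y Y (e Y) q) (Comp C X Y Y (e Y) f) = Comp C X Y Y (e Y) f"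
    and "Comp C X X Y (Comp C X Y Y (e Y) f) (Comp C X X X (e X) p) = Comp C X Y Y (e Y) f"
  using assms by (simp_all add: e_middle e_comp e_in_Hom flip: Comp_assoc)

text \<open>The component of \<open>snd\<close> at \<open>(X, U)\<close> is \<open>U\<close>, the
  identity of that object. Since \<open>H' K'\<close> is the identity by \<open>cls_lift\<close>,
  this is the identity transformation, used as the unit of the adjunction with left adjoint
  \<open>K'\<close>.\<close>

lemma nat_trans_snd_id_H'K': "nat_trans Q' Q' id_func (comp_func H' K') snd"
proof -
  interpret Id: cat_functor Q' Q' id_func
    by (intro cat_functor_id_func category.category_idempotent_completion category_Q)
  interpret HK: cat_functor Q' Q' "comp_func H' K'" by (rule functor_H'K')
  show ?thesis
  proof
    fix P assume "P \<in> Ob Q'"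
    then show "snd P \<in> Hom Q' (FOb id_func P) (FOb (comp_func H' K') P)"
      by (auto elim!: Ob_Q'E simp: comp_func_def id_func_def K'_simps H'_simps cls_lift Hom_Q'_iff)
  next
    fix P R f assume "P \<in> Ob Q'" "R \<in> Ob Q'" "f \<in> Hom Q' P R"
    then show "Comp Q' (FOb id_func P) (FOb id_func R) (FOb (comp_func H' K') R) (snd R)
          (FMor id_func P R f)
        = Comp Q' (FOb id_func P) (FOb (comp_func H' K') P) (FOb (comp_func H' K') R)
          (FMor (comp_func H' K') P R f) (snd P)"
      by (auto elim!: Ob_Q'E simp: comp_func_def id_func_def K'_simps H'_simps cls_lift
          Hom_Q'_iff idempotent_completion_Comp)
  qed
qed

text \<open>The same identity transformation, now in the direction of a counit for the left adjoint
  \<open>H'\<close>.\<close>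

lemma nat_trans_snd_H'K'_id: "nat_trans Q' Q' (comp_func H' K') id_func snd"
proof -
  interpret Id: cat_functor Q' Q' id_func
    by (intro cat_functor_id_func category.category_idempotent_completion category_Q)
  interpret HK: cat_functor Q' Q' "comp_func H' K'" by (rule functor_H'K')
  show ?thesis
  proof
    fix P assume "P \<in> Ob Q'"
    then show "snd P \<in> Hom Q' (FOb (comp_func H' K') P) (FOb id_func P)"
      by (auto elim!: Ob_Q'E simp: comp_func_def id_func_def K'_simps H'_simps cls_lift Hom_Q'_iff)
  next
    fix P R f assume "P \<in> Ob Q'" "R \<in> Ob Q'" "f \<in> Hom Q' P R"
    then show "Comp Q' (FOb (comp_func H' K') P) (FOb (comp_func H' K') R) (FOb id_func R) (snd R)
          (FMor (comp_func H' K') P R f)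
        = Comp Q' (FOb (comp_func H' K') P) (FOb id_func P) (FOb id_func R)
          (FMor id_func P R f) (snd P)"
      by (auto elim!: Ob_Q'E simp: comp_func_def id_func_def K'_simps H'_simps cls_lift
          Hom_Q'_iff idempotent_completion_Comp)
  qed
qed

lemma nat_trans_\<epsilon>_K'H'_id: "nat_trans C' C' (comp_func K' H') id_func \<epsilon>"
proof -
  interpret Id: cat_functor C' C' id_func
    by (intro cat_functor_id_func source.dom.category_idempotent_completion)
  interpret KH: cat_functor C' C' "comp_func K' H'" by (rule functor_K'H')
  show ?thesis
  proof
    fix P assume "P \<in> Ob C'"
    then show "\<epsilon> P \<in> Hom C' (FOb (comp_func K' H') P) (FOb id_func P)"
      by (auto elim!: Ob_C'E simp: comp_func_def id_func_def K'_simps H'_simps lift_cls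
          Hom_C'_iff retract_idem)
  next
    fix P R f assume "P \<in> Ob C'" "R \<in> Ob C'" "f \<in> Hom C' P R"
    then show "Comp C' (FOb (comp_func K' H') P) (FOb (comp_func K' H') R) (FOb id_func R) (\<epsilon> R)
          (FMor (comp_func K' H') P R f)
        = Comp C' (FOb (comp_func K' H') P) (FOb id_func P) (FOb id_func R)
          (FMor id_func P R f) (\<epsilon> P)"
      by (auto elim!: Ob_C'E simp: comp_func_def id_func_def K'_simps H'_simps lift_cls
          Hom_C'_iff idempotent_completion_Comp retract_natural)
  qed
qed

lemma nat_trans_\<epsilon>_id_K'H': "nat_trans C' C' id_func (comp_func K' H') \<epsilon>"
proof -
  interpret Id: cat_functor C' C' id_func
    by (intro cat_functor_id_func source.dom.category_idempotent_completion)
  interpret KH: cat_functor C' C' "comp_func K' H'" by (rule functor_K'H')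
  show ?thesis
  proof
    fix P assume "P \<in> Ob C'"
    then show "\<epsilon> P \<in> Hom C' (FOb id_func P) (FOb (comp_func K' H') P)"
      by (auto elim!: Ob_C'E simp: comp_func_def id_func_def K'_simps H'_simps lift_cls
          Hom_C'_iff retract_idem)
  next
    fix P R f assume "P \<in> Ob C'" "R \<in> Ob C'" "f \<in> Hom C' P R"
    then show "Comp C' (FOb id_func P) (FOb id_func R) (FOb (comp_func K' H') R) (\<epsilon> R)
          (FMor id_func P R f)
        = Comp C' (FOb id_func P) (FOb (comp_func K' H') P) (FOb (comp_func K' H') R)
          (FMor (comp_func K' H') P R f) (\<epsilon> P)"
      by (auto elim!: Ob_C'E simp: comp_func_def id_func_def K'_simps H'_simps lift_cls
          Hom_C'_iff idempotent_completion_Comp retract_natural)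
  qed
qed

text \<open>Once \<open>e\<close> is absorbed, the triangles reduce to idempotence: of
  \<open>lift X X U\<close> for an object \<open>(X, U)\<close> of \<open>Q'\<close>, and of the
  class of \<open>p\<close> for an object \<open>(X, p)\<close> of \<open>C'\<close>.\<close>

lemma adjunction_K'H': "adjunction Q' C' K' H' snd \<epsilon>"
proof (intro adjunction.intro adjunction_axioms.intro functor_K' functor_H'
    nat_trans_snd_id_H'K' nat_trans_\<epsilon>_K'H'_id)
  fix P assume "P \<in> Ob Q'"
  then show "Comp C' (FOb K' P) (FOb K' (FOb H' (FOb K' P))) (FOb K' P)
      (\<epsilon> (FOb K' P)) (FMor K' P (FOb H' (FOb K' P)) (snd P)) = Idm C' (FOb K' P)"
    \<comment> \<open>For \<open>P = (X, U)\<close> this instance says that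
      \<open>lift X X U\<close> is idempotent.\<close>
    using lift_Comp[of "fst P" "fst P" "fst P" "snd P" "snd P"]
    by (auto elim!: Ob_Q'E simp: K'_simps H'_simps cls_lift e_lift
        idempotent_completion_Comp idempotent_completion_Idm)
next
  fix P assume "P \<in> Ob C'"
  then show "Comp Q' (FOb H' P) (FOb H' (FOb K' (FOb H' P))) (FOb H' P)
      (FMor H' (FOb K' (FOb H' P)) P (\<epsilon> P)) (snd (FOb H' P)) = Idm Q' (FOb H' P)"
    by (auto elim!: Ob_C'E simp: K'_simps H'_simps lift_cls cls_e_comp Comp_cls
        idempotent_completion_Comp idempotent_completion_Idm)
qed

text \<open>Unit and counit trade places; the triangles again compose an idempotent with itself, up
  to absorption of \<open>e\<close>.\<close>

lemma adjunction_H'K': "adjunction C' Q' H' K' \<epsilon> snd"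
proof (intro adjunction.intro adjunction_axioms.intro functor_K' functor_H'
    nat_trans_snd_H'K'_id nat_trans_\<epsilon>_id_K'H')
  fix P assume "P \<in> Ob C'"
  then show "Comp Q' (FOb H' P) (FOb H' (FOb K' (FOb H' P))) (FOb H' P)
      (snd (FOb H' P)) (FMor H' P (FOb K' (FOb H' P)) (\<epsilon> P)) = Idm Q' (FOb H' P)"
    by (auto elim!: Ob_C'E simp: K'_simps H'_simps lift_cls cls_e_comp Comp_cls
        idempotent_completion_Comp idempotent_completion_Idm)
next
  fix P assume "P \<in> Ob Q'"
  then show "Comp C' (FOb K' P) (FOb K' (FOb H' (FOb K' P))) (FOb K' P)
      (FMor K' (FOb H' (FOb K' P)) P (snd P)) (\<epsilon> (FOb K' P)) = Idm C' (FOb K' P)"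
    using lift_Comp[of "fst P" "fst P" "fst P" "snd P" "snd P"]
    by (auto elim!: Ob_Q'E simp: K'_simps H'_simps cls_lift e_lift
        idempotent_completion_Comp idempotent_completion_Idm)
qed

text \<open>The extra bireflection condition: counit followed by unit is the square of the
  idempotent \<open>e X \<circ> p\<close>, which is the identity of the retract
  \<open>(X, e X \<circ> p)\<close>.\<close>

lemma unit_comp_counit:
  "P \<in> Ob C' \<Longrightarrow> Comp C' (FOb K' (FOb H' P)) P (FOb K' (FOb H' P)) (\<epsilon> P) (\<epsilon> P)
    = Idm C' (FOb K' (FOb H' P))"
  by (auto elim!: Ob_C'E simp: K'_simps H'_simps lift_cls retract_idem
      idempotent_completion_Comp idempotent_completion_Idm)

lemma quotient_functor_coreflection_up_to_retracts:
  "coreflection_up_to_retracts C Q (quotient_functor C e)"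
  unfolding coreflection_up_to_retracts_def coreflection_def
  using quotient_functor_is_functor functor_H' fully_faithful_K' adjunction_K'H' by blast

lemma quotient_functor_bireflection_up_to_retracts:
  "bireflection_up_to_retracts C Q (quotient_functor C e)"
  unfolding bireflection_up_to_retracts_def bireflection_def
  using quotient_functor_is_functor functor_H' fully_faithful_K' adjunction_K'H'
    adjunction_H'K' unit_comp_counit by blast

end

theorem theorem3p1:
  fixes C :: "('o, 'm) cat" and e :: "'o \<Rightarrow> 'm"
  assumes "category C"
    and "idempotent_nat_trans C e"
  shows "coreflection_up_to_retracts C (coidentifier C e) (quotient_functor C e) \<and>
    bireflection_up_to_retracts C (coidentifier C e) (quotient_functor C e)"
  using idempotent_nat_trans.quotient_functor_coreflection_up_to_retracts[OF assms(2)]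
    idempotent_nat_trans.quotient_functor_bireflection_up_to_retracts[OF assms(2)]
  by blast

end
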